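(* Let $X,Y$ be real Hilbert spaces, $T:X\to Y$ a bounded linear map, $f\in Y$, and assume that $Tu=f$ has a unique solution $u^*\in X$. Let $E(u)=\frac12\|Tu-f\|_Y^2$ for $u\in X$ and $a(u,v)=\langle Tu,Tv\rangle_Y$ for $u,v\in X$, so that $a(u,v)\le\|T\|^2\|u\|_X\|v\|_X$. Assume that $a$ is coercive with respect to a (possibly weaker) (semi-)norm $|||\cdot|||_X$ on $X$, i.e. there is $\alpha>0$ with $a(u,u)\ge\alpha|||u|||_X^2$ for all $u\in X$. Let $\mathcal F_\Theta=\{u_\theta:\theta\in\Theta\}$ be a subset of $X$ and let $L:\Theta\to\mathbb R$ be a loss function with $L(\theta)\approx E(u_\theta)$. Then for an arbitrary element $u_{\theta^*}\in\mathcal F_\Theta$, $$|||u_{\theta^*}-u^*|||_X\le\sqrt{\frac{2\delta}{\alpha}+\frac{\|T\|^2}{\alpha}\inf_{u_\psi\in\mathcal F_\Theta}\|u_\psi-u^*\|_X^2},\qquad \delta=\delta(u_{\theta^*})=E(u_{\theta^*})-\inf_{u_\psi\in\mathcal F_\Theta}E(u_\psi).$$ Further, $$|\delta(u_{\theta^*})|\le \sup_{\theta\in\Theta}|E(u_\theta)-L(\theta)|+\Bigl(L(\theta^* )-\inf_{\psi\in\Theta}L(\psi)\Bigr).$$ In addition, if $\Theta=\{\theta\in\mathbb R^p:|\theta|_\infty\le C\}$ for some $C>0$, and if the quadrature error and the optimization error are controlled, i.e. for given $\eta,\epsilon>0$ one has $\sup_{|\theta|_\infty\le C}|E(u_\theta)-L(\theta)|\le\eta$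 and $L(\theta^* )-\inf_{\psi\in\Theta}L(\psi)\le\epsilon$, then $\delta$ is a priori controlled by the quadrature and the optimization error: $\delta\le \eta+\epsilon$.
   Context: $\Theta$ is a parameter space and $\mathcal F_\Theta$ is the ansatz class, i.e. the collection of neural network functions $u_\theta$ with parameters $\theta\in\Theta$ (only the inclusion $\mathcal F_\Theta\subset X$ is relevant). $|\theta|_\infty$ is the maximum norm of the parameter vector. $L$ is a computable loss function discretizing the energy $\theta\mapsto E(u_\theta)$; if the discretization is by Monte Carlo integration, the quadrature bound by $\eta$ is understood to hold with high probability. The parameter $\theta^*\in\Theta$ is typically the output of an inexact optimization procedure applied to $\min_{\theta\in\Theta}L(\theta)$ and need not be a global minimizer.
   Formalization: The quadrature error is counted twice: |δ| ≤ 2 sup|E(u_θ)−L(θ)| + (L(θ* )−inf L) and δ ≤ 2η+ε; the printed bounds with factor 1 fail, e.g. T=id on ℝ, f=0, u_θ=θ, Θ=[−1,1], L≡1/4, θ*=1. *)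

theory Defs
  imports "HOL-Analysis.Analysis"
begin

text \<open>Nonnegativity and the value 0 at 0 follow from these two axioms.\<close>

definition seminorm :: "('x::real_vector \<Rightarrow> real) \<Rightarrow> bool" where
  "seminorm p \<longleftrightarrow> (\<forall>u v. p (u + v) \<le> p u + p v) \<and> (\<forall>c u. p (c *\<^sub>R u) = \<bar>c\<bar> * p u)"

definition energy :: "('x \<Rightarrow> 'y::real_inner) \<Rightarrow> 'y \<Rightarrow> 'x \<Rightarrow> real" where
  "energy T f u = 1/2 * (norm (T u - f))\<^sup>2"

definition energy_form :: "('x \<Rightarrow> 'y::real_inner) \<Rightarrow> 'x \<Rightarrow> 'x \<Rightarrow> real" where
  "energy_form T u v = T u \<bullet> T v"

text \<open>The infimum below is a genuine one whenever \<open>F\<close> is nonempty, because the energy is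
  bounded below by 0.\<close>

definition energy_gap :: "('x \<Rightarrow> 'y::real_inner) \<Rightarrow> 'y \<Rightarrow> 'x set \<Rightarrow> 'x \<Rightarrow> real" where
  "energy_gap T f F v = energy T f v - (INF w\<in>F. energy T f w)"

text \<open>The loss is an arbitrary real function of the parameter, so the next two quantities may be
  infinite and are taken in the extended reals. In a bound for \<open>energy_gap\<close> the quadrature
  error has to be counted twice (once at the selected parameter, once for comparing the infima
  of loss and energy): with \<open>T = id\<close> and \<open>f = 0\<close> on the real line, \<open>u \<theta> = \<theta>\<close> for
  \<open>\<bar>\<theta>\<bar> \<le> 1\<close> and the constant loss 1/4, the selected parameter 1 has energy gap 1/2,
  quadrature error 1/4 and optimization error 0.\<close>

definition quadrature_error ::
    "('x \<Rightarrow> 'y::real_inner) \<Rightarrow> 'y \<Rightarrow> 'p set \<Rightarrow> ('p \<Rightarrow> 'x) \<Rightarrow> ('p \<Rightarrow> real) \<Rightarrow> ereal" where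
  "quadrature_error T f \<Theta> u L = (SUP \<theta>\<in>\<Theta>. ereal \<bar>energy T f (u \<theta>) - L \<theta>\<bar>)"

definition optimization_error :: "'p set \<Rightarrow> ('p \<Rightarrow> real) \<Rightarrow> 'p \<Rightarrow> ereal" where
  "optimization_error \<Theta> L \<theta> = ereal (L \<theta>) - (INF \<psi>\<in>\<Theta>. ereal (L \<psi>))"

end

theory Submission
  imports Defs
begin

text \<open>Since \<open>f = T u_star\<close>, the energy of \<open>v\<close> is half of
  \<open>energy_form T (v - u_star) (v - u_star)\<close>. Coercivity bounds this quantity from below by the
  error in \<open>p\<close> and continuity bounds it from above by the error in the norm, which gives
  Cea's estimate with the energy gap measuring the failure of minimality. For the gap itself,
  replacing the energy by the loss costs the quadrature error once at the selected parameter and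
  once at its competitor.\<close>

lemma energy_nonneg: "0 \<le> energy T f v"
  by (simp add: energy_def)

lemma bdd_below_energy: "bdd_below (energy T f ` F)"
  by (rule bdd_belowI2[of _ 0]) (rule energy_nonneg)

lemma energy_gap_nonneg: "v \<in> F \<Longrightarrow> 0 \<le> energy_gap T f F v"
  by (simp add: energy_gap_def cINF_lower bdd_below_energy)

lemma energy_form_le:
  fixes T :: "'x::real_normed_vector \<Rightarrow> 'y::real_inner"
  assumes "bounded_linear T"
  shows "energy_form T u v \<le> (onorm T)\<^sup>2 * norm u * norm v"
proof -
  have "T u \<bullet> T v \<le> norm (T u) * norm (T v)"
    by (rule norm_cauchy_schwarz)
  also have "\<dots> \<le> (onorm T * norm u) * (onorm T * norm v)"
    by (intro mult_mono onorm assms) (auto intro!: mult_nonneg_nonneg onorm_pos_le assms)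
  finally show ?thesis
    by (simp add: energy_form_def power2_eq_square mult_ac)
qed

lemma energy_eq_energy_form:
  assumes "linear T"
  shows "2 * energy T (T x) v = energy_form T (v - x) (v - x)"
  by (simp add: energy_def energy_form_def linear_diff[OF assms] power2_norm_eq_inner)

text \<open>Continuity of the form bounds the energy of every competitor separately. Passing to
  infima on both sides turns this into quasi-optimality with respect to the norm.\<close>

lemma INF_energy_le:
  fixes T :: "'x::real_normed_vector \<Rightarrow> 'y::real_inner"
  assumes T: "bounded_linear T" and "F \<noteq> {}"
  shows "2 * (INF w\<in>F. energy T (T x) w) \<le> (onorm T)\<^sup>2 * (INF w\<in>F. (norm (w - x))\<^sup>2)"
proof -
  let ?m = "INF w\<in>F. energy T (T x) w"
  have le: "2 * ?m \<le> (onorm T)\<^sup>2 * (norm (w - x))\<^sup>2" if "w \<in> F" for w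
  proof -
    have "?m \<le> energy T (T x) w"
      by (rule cINF_lower[OF bdd_below_energy that])
    then have "2 * ?m \<le> energy_form T (w - x) (w - x)"
      using energy_eq_energy_form[OF bounded_linear.linear[OF T], of x w] by linarith
    also have "\<dots> \<le> (onorm T)\<^sup>2 * (norm (w - x))\<^sup>2"
      using energy_form_le[OF T, of "w - x" "w - x"] by (simp add: power2_eq_square mult_ac)
    finally show ?thesis .
  qed
  show ?thesis
  \<comment> \<open>The constant is moved out of the infimum by dividing by its square. If it
    vanishes, \<open>le\<close> at any element of \<open>F\<close> is already the claim.\<close>
  proof (cases "onorm T = 0")
    case True
    with le \<open>F \<noteq> {}\<close> show ?thesis by auto
  next
    case False
    then have pos: "(onorm T)\<^sup>2 > 0" by simp
    have "2 * ?m / (onorm T)\<^sup>2 \<le> (INF w\<in>F. (norm (w - x))\<^sup>2)"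
      using \<open>F \<noteq> {}\<close>
      by (rule cINF_greatest) (use le pos in \<open>simp add: pos_divide_le_eq mult.commute\<close>)
    then show ?thesis
      using pos by (simp add: pos_divide_le_eq mult.commute)
  qed
qed

text \<open>The energy of \<open>v\<close> splits into its gap and the infimal energy. The gap is
  kept as it stands, and \<open>INF_energy_le\<close> turns the infimum into the best approximation
  error.\<close>

lemma cea_estimate:
  fixes T :: "'x::real_normed_vector \<Rightarrow> 'y::real_inner"
  assumes T: "bounded_linear T" and \<alpha>: "\<alpha> > 0"
    and coercive: "\<And>u. energy_form T u u \<ge> \<alpha> * (p u)\<^sup>2"
    and "F \<noteq> {}"
  shows "p (v - x) \<le> sqrt (2 * energy_gap T (T x) F v / \<alpha>
           + (onorm T)\<^sup>2 / \<alpha> * (INF w\<in>F. (norm (w - x))\<^sup>2))"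
proof (rule real_le_rsqrt)
  have "\<alpha> * (p (v - x))\<^sup>2 \<le> 2 * energy T (T x) v"
    using coercive energy_eq_energy_form[OF bounded_linear.linear[OF T], of x v] by simp
  also have "\<dots> = 2 * energy_gap T (T x) F v + 2 * (INF w\<in>F. energy T (T x) w)"
    by (simp add: energy_gap_def)
  also have "\<dots> \<le> 2 * energy_gap T (T x) F v + (onorm T)\<^sup>2 * (INF w\<in>F. (norm (w - x))\<^sup>2)"
    using INF_energy_le[OF T \<open>F \<noteq> {}\<close>] by simp
  finally show "(p (v - x))\<^sup>2 \<le> 2 * energy_gap T (T x) F v / \<alpha>
      + (onorm T)\<^sup>2 / \<alpha> * (INF w\<in>F. (norm (w - x))\<^sup>2)"
    using \<alpha> by (simp add: pos_le_divide_eq mult.commute flip: add_divide_distrib)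
qed

text \<open>For every competitor \<psi>, the energy at \<theta> is at most L \<theta> + q, hence at
  most L \<psi> + r + q, hence at most the energy at \<psi> plus 2 q + r.\<close>

lemma energy_gap_le_real:
  assumes "\<theta> \<in> \<Theta>" and "quadrature_error T f \<Theta> u L \<le> ereal q"
    and "optimization_error \<Theta> L \<theta> \<le> ereal r"
  shows "energy_gap T f (u ` \<Theta>) (u \<theta>) \<le> 2 * q + r"
proof -
  have quad: "\<bar>energy T f (u \<psi>) - L \<psi>\<bar> \<le> q" if "\<psi> \<in> \<Theta>" for \<psi>
    using assms(2) that unfolding quadrature_error_def SUP_le_iff by simp
  have opt: "L \<theta> - L \<psi> \<le> r" if "\<psi> \<in> \<Theta>" for \<psi>
  proof -
    \<comment> \<open>Extended subtraction is monotone even where the infimum of the loss is minus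
      infinity, so no lower bound on \<open>L\<close> has to be shown first.\<close>
    have "ereal (L \<theta>) - ereal (L \<psi>) \<le> optimization_error \<Theta> L \<theta>"
      unfolding optimization_error_def by (intro ereal_minus_mono order_refl INF_lower that)
    with assms(3) show ?thesis
      by (metis ereal_less_eq(3) ereal_minus(1) order_trans)
  qed
  have "energy T f (u \<theta>) - (2 * q + r) \<le> (INF w\<in>u ` \<Theta>. energy T f w)"
  proof (rule cINF_greatest)
    fix w assume "w \<in> u ` \<Theta>"
    then obtain \<psi> where \<psi>: "\<psi> \<in> \<Theta>" "w = u \<psi>" by blast
    show "energy T f (u \<theta>) - (2 * q + r) \<le> energy T f w"
      using quad[OF \<open>\<theta> \<in> \<Theta>\<close>] quad[OF \<psi>(1)] opt[OF \<psi>(1)]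
      unfolding \<psi>(2) by linarith
  qed (use \<open>\<theta> \<in> \<Theta>\<close> in blast)
  then show ?thesis by (simp add: energy_gap_def)
qed

text \<open>If either error is infinite, the right-hand side is infinite; otherwise the real version
  applies.\<close>

lemma energy_gap_le:
  assumes "\<theta> \<in> \<Theta>"
  shows "ereal \<bar>energy_gap T f (u ` \<Theta>) (u \<theta>)\<bar>
    \<le> 2 * quadrature_error T f \<Theta> u L + optimization_error \<Theta> L \<theta>"
proof -
  let ?Q = "quadrature_error T f \<Theta> u L" and ?O = "optimization_error \<Theta> L \<theta>"
  \<comment> \<open>Nonnegativity excludes minus infinity, so an error that is not infinite is a
    real number. Both bounds come from \<theta> being one of the parameters in \<Theta>.\<close>
  have Q: "0 \<le> ?Q"
    unfolding quadrature_error_def by (rule SUP_upper2[OF assms]) simp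
  have O: "0 \<le> ?O"
    unfolding optimization_error_def by (intro ereal_diff_positive INF_lower assms)
  show ?thesis
  proof (cases "?Q = \<infinity> \<or> ?O = \<infinity>")
    case True
    then have "2 * ?Q + ?O = \<infinity>" by auto
    then show ?thesis by (simp only: ereal_less_eq(1))
  next
    case False
    then obtain q r where qr: "?Q = ereal q" "?O = ereal r"
      using Q O by (cases ?Q; cases ?O) auto
    have "\<bar>energy_gap T f (u ` \<Theta>) (u \<theta>)\<bar> \<le> 2 * q + r"
      using energy_gap_le_real[OF assms, of T f u L q r] qr assms
      by (simp add: energy_gap_nonneg)
    then have "ereal \<bar>energy_gap T f (u ` \<Theta>) (u \<theta>)\<bar> \<le> ereal (2 * q + r)"
      by simp
    also have "\<dots> = 2 * ?Q + ?O"
      unfolding qr by simp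
    finally show ?thesis .
  qed
qed

theorem theorem2:
  fixes T :: "'x::{real_inner, complete_space} \<Rightarrow> 'y::{real_inner, complete_space}"
    and f :: 'y and u_star :: 'x
    and p :: "'x \<Rightarrow> real" and \<alpha> :: real
  assumes "bounded_linear T"
    and "\<exists>!u. T u = f" and "T u_star = f"
    and "seminorm p"
    and "\<alpha> > 0" and "\<forall>u. energy_form T u u \<ge> \<alpha> * (p u)\<^sup>2"
  shows
    "(\<forall>u v. energy_form T u v \<le> (onorm T)\<^sup>2 * norm u * norm v) \<and>
     (\<forall>(\<Theta> :: 'q set) (u :: 'q \<Rightarrow> 'x) (L :: 'q \<Rightarrow> real). \<forall>\<theta>_star\<in>\<Theta>.
        p (u \<theta>_star - u_star)
          \<le> sqrt (2 * energy_gap T f (u ` \<Theta>) (u \<theta>_star) / \<alpha>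
                   + (onorm T)\<^sup>2 / \<alpha> * (INF w\<in>u ` \<Theta>. (norm (w - u_star))\<^sup>2)) \<and>
        ereal \<bar>energy_gap T f (u ` \<Theta>) (u \<theta>_star)\<bar>
          \<le> 2 * quadrature_error T f \<Theta> u L + optimization_error \<Theta> L \<theta>_star) \<and>
     (\<forall>(\<Theta> :: (real ^ 'n) set) (u :: real ^ 'n \<Rightarrow> 'x) (L :: real ^ 'n \<Rightarrow> real).
        \<forall>\<theta>_star\<in>\<Theta>. \<forall>C>0. \<forall>\<eta>>0. \<forall>\<epsilon>>0.
          \<Theta> = {\<theta>. infnorm \<theta> \<le> C} \<longrightarrow>
          quadrature_error T f \<Theta> u L \<le> ereal \<eta> \<longrightarrow>
          optimization_error \<Theta> L \<theta>_star \<le> ereal \<epsilon> \<longrightarrow>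
          energy_gap T f (u ` \<Theta>) (u \<theta>_star) \<le> 2 * \<eta> + \<epsilon>)"
proof (intro conjI allI ballI impI)
  show "energy_form T u v \<le> (onorm T)\<^sup>2 * norm u * norm v" for u v
    using assms(1) by (rule energy_form_le)
next
  fix \<Theta> :: "'q set" and u :: "'q \<Rightarrow> 'x" and \<theta>
  assume "\<theta> \<in> \<Theta>"
  then have "u ` \<Theta> \<noteq> {}" by blast
  from cea_estimate[OF assms(1,5) spec[OF assms(6)] this, of "u \<theta>" u_star]
  show "p (u \<theta> - u_star)
      \<le> sqrt (2 * energy_gap T f (u ` \<Theta>) (u \<theta>) / \<alpha>
               + (onorm T)\<^sup>2 / \<alpha> * (INF w\<in>u ` \<Theta>. (norm (w - u_star))\<^sup>2))"
    by (simp only: assms(3))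
\<comment> \<open>What remains is the extended real bound and its real version with \<eta> for
  \<open>q\<close> and \<epsilon> for \<open>r\<close>.\<close>
qed (rule energy_gap_le energy_gap_le_real; assumption)+

end
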